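(* Let $\mathbf c$ be a random class label, let $p(\cdot\mid \mathbf c)$ be the class-conditional data densities on $\mathbb R^d$, let $p(\mathbf x):=\mathbb E_{\mathbf c}[p(\mathbf x\mid\mathbf c)]$, let $\eta\ge 0$, and define $$h(\mathbf x\mid\mathbf c):=p(\mathbf x\mid\mathbf c)+\eta\,\bigl(p(\mathbf x\mid\mathbf c)-p(\mathbf x)\bigr).$$ Assume that there is a set $K\subset\mathbb R^d$ with finite volume $|K|<\infty$ such that $\operatorname{supp} h(\cdot\mid\mathbf c)\subseteq K$ for every $\mathbf c$, and let $0<\delta<\frac1{|K|}$. Consider the problem $$\max_{p_{\theta}}\ \mathbb E_{\mathbf c,\ \mathbf x\sim p(\cdot\mid\mathbf c)}\bigl[\log p_\theta(\mathbf x\mid\mathbf c)\bigr]+\eta\,\mathbb E_{\mathbf c,\tilde{\mathbf c},\ \mathbf x\sim p(\cdot\mid\mathbf c),\ \mathbf y\sim p(\cdot\mid\tilde{\mathbf c})}\left[\log\frac{p_\theta(\mathbf x\mid\mathbf c)}{p_\theta(\mathbf y\mid\mathbf c)}\right],$$ where the maximum is over all families of conditional probability densities $p_\theta(\cdot\mid\mathbf c)$ on $\mathbb R^d$ satisfying $p_\theta(\mathbf x\mid\mathbf c)\ge\delta$ for all $\mathbf x\in K$ and all $\mathbf c$. Then the optimal solution is $$p_{\theta^*}(\mathbf x\mid\mathbf c)=\begin{cases}\max\left\{\dfrac{h(\mathbf x\mid\mathbf c)}{Z(\mathbf c)},\,\delta\right\}, & \mathbf x\in K,\\[2mm] 0,&\mathbf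 x\notin K,\end{cases}$$ where $Z(\mathbf c)>0$ is the normalizing constant, i.e. the constant for which $\int p_{\theta^*}(\mathbf x\mid\mathbf c)\,d\mathbf x=1$.
   Context: The labels $\mathbf c$ and $\tilde{\mathbf c}$ are drawn independently from the class prior; given the labels, samples are drawn independently from the indicated class-conditional densities. The model $p_\theta$ is unrestricted (nonparametric): the optimization variable is the family of conditional densities itself, and optimal solutions are identified up to Lebesgue-null sets (and up to classes of prior probability zero). By linearity of expectation the objective is understood as $\mathbb E_{\mathbf c}\left[\int \log p_\theta(\mathbf x\mid\mathbf c)\,h(\mathbf x\mid\mathbf c)\,d\mathbf x\right]$, where points outside $K$, at which $h=0$, contribute $0$.
   Formalization: That the given family is the only optimal solution (up to null sets and classes of prior probability zero) is asserted only when the maximum is finite; if the maximum is +∞, other families attain it too. Its optimality is asserted in all cases. *)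

theory Defs
  imports "HOL-Probability.Probability"
begin

text \<open>
  Signed integral of an extended-real function, as the integral of the positive part minus
  the integral of the negative part (\<^const>\<open>e2ennreal\<close> maps negative arguments to 0).
  The value is meaningful only if the two parts are not both infinite, which is what
  \<open>quasi_integrable\<close> demands; in \<^typ>\<open>ereal\<close> the difference \<open>\<infinity> - \<infinity>\<close> is \<open>\<infinity>\<close>.
\<close>

definition ereal_integral :: "'a measure \<Rightarrow> ('a \<Rightarrow> ereal) \<Rightarrow> ereal" where
  "ereal_integral M f =
     enn2ereal (\<integral>\<^sup>+ x. e2ennreal (f x) \<partial>M) - enn2ereal (\<integral>\<^sup>+ x. e2ennreal (- f x) \<partial>M)"

definition quasi_integrable :: "'a measure \<Rightarrow> ('a \<Rightarrow> ereal) \<Rightarrow> bool" where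
  "quasi_integrable M f \<longleftrightarrow>
     f \<in> borel_measurable M \<and>
     ((\<integral>\<^sup>+ x. e2ennreal (f x) \<partial>M) < \<infinity> \<or> (\<integral>\<^sup>+ x. e2ennreal (- f x) \<partial>M) < \<infinity>)"

definition prob_density :: "(real ^ 'd \<Rightarrow> real) \<Rightarrow> bool" where
  "prob_density f \<longleftrightarrow>
     (\<forall>x. 0 \<le> f x) \<and> integrable lebesgue f \<and> (\<integral>x. f x \<partial>lebesgue) = 1"

text \<open>
  With infinitely many classes \<open>\<lambda>c. p c x\<close> may fail to be integrable on a Lebesgue-null set of
  points \<open>x\<close>; there \<open>marginal prior p x\<close> is 0.
\<close>

definition marginal :: "'c pmf \<Rightarrow> ('c \<Rightarrow> real ^ 'd \<Rightarrow> real) \<Rightarrow> real ^ 'd \<Rightarrow> real" where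
  "marginal prior p x = measure_pmf.expectation prior (\<lambda>c. p c x)"

definition guided :: "'c pmf \<Rightarrow> real \<Rightarrow> ('c \<Rightarrow> real ^ 'd \<Rightarrow> real) \<Rightarrow> 'c \<Rightarrow> real ^ 'd \<Rightarrow> real" where
  "guided prior \<eta> p c x = p c x + \<eta> * (p c x - marginal prior p x)"

text \<open>
  In the objective the weight \<open>h c x\<close> vanishes outside \<open>K\<close> and feasible families are at least
  \<open>\<delta> > 0\<close> on \<open>K\<close>, so the value of \<^const>\<open>ln\<close> at 0 never matters: such points contribute 0.
\<close>

definition class_objective :: "(real ^ 'd \<Rightarrow> real) \<Rightarrow> (real ^ 'd \<Rightarrow> real) \<Rightarrow> ereal" where
  "class_objective h q = ereal_integral lebesgue (\<lambda>x. ereal (ln (q x) * h x))"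

definition objective ::
  "'c pmf \<Rightarrow> ('c \<Rightarrow> real ^ 'd \<Rightarrow> real) \<Rightarrow> ('c \<Rightarrow> real ^ 'd \<Rightarrow> real) \<Rightarrow> ereal" where
  "objective prior h q = ereal_integral (measure_pmf prior) (\<lambda>c. class_objective (h c) (q c))"

definition objective_defined ::
  "'c pmf \<Rightarrow> ('c \<Rightarrow> real ^ 'd \<Rightarrow> real) \<Rightarrow> ('c \<Rightarrow> real ^ 'd \<Rightarrow> real) \<Rightarrow> bool" where
  "objective_defined prior h q \<longleftrightarrow>
     (\<forall>c \<in> set_pmf prior. quasi_integrable lebesgue (\<lambda>x. ereal (ln (q c x) * h c x))) \<and>
     quasi_integrable (measure_pmf prior) (\<lambda>c. class_objective (h c) (q c))"

definition feasible :: "(real ^ 'd) set \<Rightarrow> real \<Rightarrow> ('c \<Rightarrow> real ^ 'd \<Rightarrow> real) \<Rightarrow> bool" where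
  "feasible K \<delta> q \<longleftrightarrow> (\<forall>c. prob_density (q c) \<and> (\<forall>x\<in>K. \<delta> \<le> q c x))"

definition optimal ::
  "'c pmf \<Rightarrow> ('c \<Rightarrow> real ^ 'd \<Rightarrow> real) \<Rightarrow> (real ^ 'd) set \<Rightarrow> real \<Rightarrow>
     ('c \<Rightarrow> real ^ 'd \<Rightarrow> real) \<Rightarrow> bool" where
  "optimal prior h K \<delta> q \<longleftrightarrow>
     feasible K \<delta> q \<and> objective_defined prior h q \<and>
     (\<forall>q'. feasible K \<delta> q' \<and> objective_defined prior h q' \<longrightarrow>
        objective prior h q' \<le> objective prior h q)"

definition clipped :: "(real ^ 'd \<Rightarrow> real) \<Rightarrow> (real ^ 'd) set \<Rightarrow> real \<Rightarrow> real \<Rightarrow> real ^ 'd \<Rightarrow> real" where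
  "clipped h K \<delta> z x = (if x \<in> K then max (h x / z) \<delta> else 0)"

end

theory Submission imports Defs begin

text \<open>
  By linearity the problem splits over the classes. For one class with weight \<open>w\<close> of integral 1,
  the clipped density \<open>s\<close> satisfies \<open>w ln q \<le> w ln s + z (q - s)\<close> on \<open>K\<close> for every feasible \<open>q\<close>,
  with equality only where \<open>q = s\<close>. Integrating, the last term contributes at most 0 because both
  densities have mass 1 and \<open>s\<close> has all its mass on \<open>K\<close>. Since \<open>ln s \<ge> ln \<delta>\<close>, with equality where
  \<open>w < 0\<close>, the negative part of \<open>w ln s\<close> is at most \<open>\<bar>ln \<delta>\<bar> \<bar>w\<bar>\<close>, whose integral is bounded uniformly
  in the class; so the optimal value is never \<open>-\<infinity>\<close>, and when it is finite equality propagates back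
  to the integrands. The normalizer exists by the intermediate value theorem in \<open>t = 1 / z \<in> {0..1}\<close>.
\<close>

section \<open>Signed integrals of extended-real functions\<close>

text \<open>The positive part grows and the negative part shrinks. Subtraction in
  \<open>ereal\<close> respects this even with
  \<open>\<infinity> - \<infinity> = \<infinity>\<close>: an infinite minuend on the left forces one
  on the right.\<close>

lemma ereal_integral_mono:
  assumes "AE x in M. f x \<le> g x"
  shows "ereal_integral M f \<le> ereal_integral M g"
  unfolding ereal_integral_def
proof (rule ereal_minus_mono)
  show "enn2ereal (\<integral>\<^sup>+ x. e2ennreal (f x) \<partial>M) \<le> enn2ereal (\<integral>\<^sup>+ x. e2ennreal (g x) \<partial>M)"
    using assms by (auto simp: less_eq_ennreal.rep_eq [symmetric]
        intro!: nn_integral_mono_AE e2ennreal_mono elim!: eventually_mono)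
  show "enn2ereal (\<integral>\<^sup>+ x. e2ennreal (- g x) \<partial>M) \<le> enn2ereal (\<integral>\<^sup>+ x. e2ennreal (- f x) \<partial>M)"
    using assms by (auto simp: less_eq_ennreal.rep_eq [symmetric]
        intro!: nn_integral_mono_AE e2ennreal_mono elim!: eventually_mono)
qed

lemma ereal_integral_cong_AE:
  assumes "AE x in M. f x = g x"
  shows "ereal_integral M f = ereal_integral M g"
  using assms by (intro antisym ereal_integral_mono) (auto elim: eventually_mono)

lemma ereal_integral_eq_integral:
  assumes "integrable M f"
  shows "ereal_integral M (\<lambda>x. ereal (f x)) = ereal (integral\<^sup>L M f)"
proof -
  have "(\<integral>\<^sup>+ x. ennreal (f x) \<partial>M) < \<infinity>" "(\<integral>\<^sup>+ x. ennreal (- f x) \<partial>M) < \<infinity>"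
    using assms by (auto simp: real_integrable_def less_top)
  then show ?thesis
    unfolding ereal_integral_def real_lebesgue_integral_def [OF assms]
    by (cases "\<integral>\<^sup>+ x. ennreal (f x) \<partial>M"; cases "\<integral>\<^sup>+ x. ennreal (- f x) \<partial>M")
      (auto simp: e2ennreal_ereal enn2ereal_ennreal)
qed

text \<open>Since \<open>\<infinity> - \<infinity>\<close> counts as \<open>\<infinity>\<close>, a
  finite difference excludes this case as well as a single infinite part.\<close>

lemma ereal_integral_finite_parts:
  assumes "\<bar>ereal_integral M f\<bar> \<noteq> \<infinity>"
  shows "(\<integral>\<^sup>+ x. e2ennreal (f x) \<partial>M) < \<infinity>" "(\<integral>\<^sup>+ x. e2ennreal (- f x) \<partial>M) < \<infinity>"
  using assms unfolding ereal_integral_def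
  by (cases "\<integral>\<^sup>+ x. e2ennreal (f x) \<partial>M"; cases "\<integral>\<^sup>+ x. e2ennreal (- f x) \<partial>M";
      auto simp: enn2ereal_ennreal)+

text \<open>Leads from a finite extended value back to Bochner integrals, where linearity is
  available.\<close>

lemma ereal_integral_finite_imp_integrable:
  assumes "f \<in> borel_measurable M" "\<bar>ereal_integral M f\<bar> \<noteq> \<infinity>"
  shows "AE x in M. f x = ereal (real_of_ereal (f x))"
    and "integrable M (\<lambda>x. real_of_ereal (f x))"
    and "ereal_integral M f = ereal (\<integral>x. real_of_ereal (f x) \<partial>M)"
proof -
  note [measurable] = assms(1)
  note fin = ereal_integral_finite_parts [OF assms(2)]
  have "AE x in M. e2ennreal (f x) \<noteq> \<infinity>" "AE x in M. e2ennreal (- f x) \<noteq> \<infinity>"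
    using fin by (intro nn_integral_PInf_AE; simp)+
  then show ae: "AE x in M. f x = ereal (real_of_ereal (f x))"
  proof eventually_elim
    case (elim x)
    then show ?case by (cases "f x") auto
  qed
  have "(\<integral>\<^sup>+ x. e2ennreal (f x) \<partial>M) = (\<integral>\<^sup>+ x. ennreal (real_of_ereal (f x)) \<partial>M)"
    using ae by (intro nn_integral_cong_AE) (auto elim!: eventually_mono, metis e2ennreal_ereal)
  moreover have "(\<integral>\<^sup>+ x. e2ennreal (- f x) \<partial>M) = (\<integral>\<^sup>+ x. ennreal (- real_of_ereal (f x)) \<partial>M)"
    using ae by (intro nn_integral_cong_AE)
      (auto elim!: eventually_mono, metis e2ennreal_ereal uminus_ereal.simps(1))
  ultimately show int: "integrable M (\<lambda>x. real_of_ereal (f x))"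
    using fin by (auto simp: real_integrable_def)
  show "ereal_integral M f = ereal (\<integral>x. real_of_ereal (f x) \<partial>M)"
    using ereal_integral_cong_AE [OF ae] ereal_integral_eq_integral [OF int] by simp
qed

text \<open>Equality case of monotonicity: the real versions differ by a nonnegative function of
  integral 0. It serves twice, over the points for one class and over the classes.\<close>

lemma ereal_integral_eq_imp_AE_eq:
  assumes "f \<in> borel_measurable M" "g \<in> borel_measurable M" "AE x in M. f x \<le> g x"
    and "ereal_integral M f = ereal_integral M g" "\<bar>ereal_integral M g\<bar> \<noteq> \<infinity>"
  shows "AE x in M. f x = g x"
proof -
  let ?f = "\<lambda>x. real_of_ereal (f x)" and ?g = "\<lambda>x. real_of_ereal (g x)"
  have f: "AE x in M. f x = ereal (?f x)" "integrable M ?f" "ereal_integral M f = ereal (\<integral>x. ?f x \<partial>M)"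
    using ereal_integral_finite_imp_integrable [of f M] assms by auto
  have g: "AE x in M. g x = ereal (?g x)" "integrable M ?g" "ereal_integral M g = ereal (\<integral>x. ?g x \<partial>M)"
    using ereal_integral_finite_imp_integrable [of g M] assms by auto
  have "AE x in M. 0 \<le> ?g x - ?f x"
    using f(1) g(1) assms(3)
  proof eventually_elim
    case (elim x)
    then show ?case by (metis diff_ge_0_iff_ge ereal_less_eq(3))
  qed
  moreover have "(\<integral>x. ?g x - ?f x \<partial>M) = 0"
    using f g assms(4) by simp
  ultimately have "AE x in M. ?g x - ?f x = 0"
    using f(2) g(2) by (subst (asm) integral_nonneg_eq_0_iff_AE) auto
  then show ?thesis
    using f(1) g(1)
  proof eventually_elim
    case (elim x)
    then show ?case by (metis eq_iff_diff_eq_0)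
  qed
qed

section \<open>Pointwise tangent inequality\<close>

text \<open>
  With \<open>s = max (a / z) \<delta>\<close>: the weight \<open>z\<close> is a Lagrange multiplier of the mass constraint, because
  \<open>a / s \<le> z\<close> with equality unless \<open>s = \<delta>\<close>, the smallest value allowed for \<open>t\<close>.
\<close>

lemma log_clip_tangent:
  fixes a z \<delta> t :: real
  assumes "0 < z" "0 < \<delta>" "\<delta> \<le> t"
  defines "s \<equiv> max (a / z) \<delta>"
  shows "ln t * a \<le> ln s * a + z * (t - s)"
    and "ln t * a = ln s * a + z * (t - s) \<Longrightarrow> t = s"
proof -
  have s: "0 < s" and t: "0 < t" using assms by auto
  have "ln t * a \<le> ln s * a + z * (t - s) \<and> (ln t * a = ln s * a + z * (t - s) \<longrightarrow> t = s)"
  proof (cases "a > 0")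
    case True
    have slope: "a * (t / s - 1) \<le> z * (t - s)"
    proof (cases "a / z \<ge> \<delta>")
      case True
      then have "a = z * s" using assms(1) by (simp add: s_def field_simps)
      then show ?thesis using s by (simp add: field_simps)
    next
      case False
      then have "s = \<delta>" "a \<le> z * s" using assms(1) by (auto simp: s_def field_simps)
      then have "a * (t - s) \<le> z * s * (t - s)"
        using assms(3) by (intro mult_right_mono) auto
      then show ?thesis using s by (simp add: field_simps)
    qed
    have ln: "ln t = ln s + ln (t / s)" using s t by (simp add: ln_div)
    \<comment> \<open>Concavity of \<open>ln\<close>; equality only at \<open>t / s = 1\<close>
      gives the uniqueness claim for positive \<open>a\<close>.\<close>
    have le: "ln (t / s) \<le> t / s - 1" using s t by (intro ln_le_minus_one) auto
    have "ln t * a = ln s * a + a * ln (t / s)" by (simp add: ln algebra_simps)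
    moreover have "a * ln (t / s) \<le> a * (t / s - 1)"
      using le True by (intro mult_left_mono) auto
    moreover have "t = s" if "a * ln (t / s) = a * (t / s - 1)"
    proof -
      have "ln (t / s) = t / s - 1" using that True by simp
      then have "t / s = 1" using s t by (intro ln_eq_minus_one) auto
      then show ?thesis using s by simp
    qed
    ultimately show ?thesis using slope by linarith
  next
    case False
    then have "a / z \<le> 0" using assms(1) by (simp add: divide_nonpos_pos)
    then have sd: "s = \<delta>" using assms(2) by (simp add: s_def)
    \<comment> \<open>Here \<open>s = \<delta> \<le> t\<close> and a nonpositive weight favours the
      smaller argument. Strictness comes from the term \<open>z * (t - s)\<close> alone, which also
      covers \<open>a = 0\<close>.\<close>
    have "ln t * a \<le> ln s * a"
      using False s assms(3) sd by (intro mult_right_mono_neg) auto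
    moreover have "0 \<le> z * (t - s)" using assms sd by simp
    moreover have "t = s" if "z * (t - s) \<le> 0"
      using that assms sd by (simp add: mult_le_0_iff)
    ultimately show ?thesis by fastforce
  qed
  then show "ln t * a \<le> ln s * a + z * (t - s)"
    and "ln t * a = ln s * a + z * (t - s) \<Longrightarrow> t = s" by auto
qed

section \<open>The clipped density and its normalizer\<close>

text \<open>Off \<open>K\<close> both arguments of the maximum are 0. Without the case distinction,
  integrability follows from closure under \<open>max\<close>.\<close>

lemma clipped_eq_max:
  assumes "{x. w x \<noteq> 0} \<subseteq> K"
  shows "clipped w K \<delta> z = (\<lambda>x. max (w x / z) (\<delta> * indicat_real K x))"
proof
  fix x show "clipped w K \<delta> z x = max (w x / z) (\<delta> * indicat_real K x)"
    using assms by (cases "x \<in> K"; cases "w x = 0") (auto simp: clipped_def)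
qed

lemma integrable_clipped:
  assumes "integrable lebesgue w" "K \<in> lmeasurable" "{x. w x \<noteq> 0} \<subseteq> K"
  shows "integrable lebesgue (clipped w K \<delta> z)"
  unfolding clipped_eq_max [OF assms(3)] using assms(1,2)
  by (intro integrable_max integrable_divide integrable_mult_right)
    (auto simp: integrable_indicator_iff fmeasurable_def lmeasurable_iff_integrable)

text \<open>When the floor is active almost everywhere on \<open>K\<close>, the mass is below 1 by
  the choice of \<open>\<delta>\<close>. This gives the left endpoint for the intermediate value
  theorem and the contradiction in the uniqueness of the normalizer.\<close>

lemma integral_clipped_floor:
  assumes "integrable lebesgue w" "K \<in> lmeasurable" "{x. w x \<noteq> 0} \<subseteq> K" "0 < \<delta>"
    and "AE x in lebesgue. x \<in> K \<longrightarrow> w x / z \<le> \<delta>"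
  shows "(\<integral>x. clipped w K \<delta> z x \<partial>lebesgue) = \<delta> * measure lebesgue K"
proof -
  have "(\<integral>x. clipped w K \<delta> z x \<partial>lebesgue) = (\<integral>x. \<delta> * indicat_real K x \<partial>lebesgue)"
  proof (rule integral_cong_AE)
    show "clipped w K \<delta> z \<in> borel_measurable lebesgue"
      using integrable_clipped [OF assms(1,2,3)] by auto
    show "AE x in lebesgue. clipped w K \<delta> z x = \<delta> * indicat_real K x"
      using assms(5) by eventually_elim (auto simp: clipped_def)
  qed (use assms(2) in auto)
  then show ?thesis using assms(2) by simp
qed

lemma clipped_normalizer:
  fixes w :: "real ^ 'd \<Rightarrow> real"
  assumes w: "integrable lebesgue w" "(\<integral>x. w x \<partial>lebesgue) = 1"
    and K: "K \<in> lmeasurable" "{x. w x \<noteq> 0} \<subseteq> K"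
    and \<delta>: "0 < \<delta>" "\<delta> * measure lebesgue K < 1"
  obtains z where "0 < z"
    "\<And>z'. 0 < z' \<Longrightarrow> (\<integral>x. clipped w K \<delta> z' x \<partial>lebesgue) = 1 \<longleftrightarrow> z' = z"
proof -
  have int: "integrable lebesgue (clipped w K \<delta> z)" for z
    using w(1) K by (rule integrable_clipped)
  define F where "F t = (\<integral>x. max (w x * t) (\<delta> * indicat_real K x) \<partial>lebesgue)" for t
  \<comment> \<open>This includes \<open>t = 0\<close>: division by 0 yields 0, so
    \<open>w x / (1 / 0)\<close> agrees with \<open>w x * 0\<close>.\<close>
  have F_eq: "F t = (\<integral>x. clipped w K \<delta> (1 / t) x \<partial>lebesgue)" for t
    by (simp add: F_def clipped_eq_max [OF K(2)])
  have intF: "integrable lebesgue (\<lambda>x. max (w x * t) (\<delta> * indicat_real K x))" for t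
    using int [of "1 / t"] by (simp add: clipped_eq_max [OF K(2)])
  \<comment> \<open>Taking the maximum with a fixed number is 1-Lipschitz, so the L1 norm of
    \<open>w\<close> is a Lipschitz constant for \<open>F\<close>.\<close>
  have lip: "\<bar>F s - F t\<bar> \<le> \<bar>s - t\<bar> * (\<integral>x. \<bar>w x\<bar> \<partial>lebesgue)" for s t
  proof -
    have "\<bar>F s - F t\<bar> = \<bar>\<integral>x. max (w x * s) (\<delta> * indicat_real K x) - max (w x * t) (\<delta> * indicat_real K x) \<partial>lebesgue\<bar>"
      unfolding F_def by (subst Bochner_Integration.integral_diff [OF intF intF]) simp
    also have "\<dots> \<le> (\<integral>x. \<bar>max (w x * s) (\<delta> * indicat_real K x) - max (w x * t) (\<delta> * indicat_real K x)\<bar> \<partial>lebesgue)"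
      by (rule integral_abs_bound)
    also have "\<dots> \<le> (\<integral>x. \<bar>s - t\<bar> * \<bar>w x\<bar> \<partial>lebesgue)"
    proof (rule integral_mono)
      fix x
      have "\<bar>max (w x * s) (\<delta> * indicat_real K x) - max (w x * t) (\<delta> * indicat_real K x)\<bar> \<le> \<bar>w x * s - w x * t\<bar>"
        by linarith
      then show "\<bar>max (w x * s) (\<delta> * indicat_real K x) - max (w x * t) (\<delta> * indicat_real K x)\<bar> \<le> \<bar>s - t\<bar> * \<bar>w x\<bar>"
        by (metis right_diff_distrib abs_mult mult.commute)
    qed (use intF w(1) in \<open>auto intro!: integrable_abs Bochner_Integration.integrable_diff\<close>)
    finally show ?thesis by simp
  qed
  have cont: "continuous_on {0..1} F"
  proof (rule continuous_on_subset [of UNIV])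
    have "\<bar>\<integral>x. \<bar>w x\<bar> \<partial>lebesgue\<bar>-lipschitz_on UNIV F"
      using lip by (intro lipschitz_onI) (auto simp: dist_real_def mult.commute)
    then show "continuous_on UNIV F"
      by (rule lipschitz_on_continuous_on)
  qed auto
  have F0: "F 0 = \<delta> * measure lebesgue K"
    unfolding F_eq using w(1) K \<delta>(1) by (intro integral_clipped_floor) auto
  \<comment> \<open>At \<open>t = 1\<close> the maximum dominates \<open>w\<close>, which has
    integral 1.\<close>
  have "1 \<le> F 1"
    using integral_mono [OF w(1) intF [of 1]] w(2) by (simp add: F_def)
  then obtain t where t: "0 \<le> t" "F t = 1"
    using IVT' [of F 0 1 1] F0 \<delta>(2) cont by auto
  have "t \<noteq> 0" using t F0 \<delta>(2) by auto
  \<comment> \<open>A larger divisor lowers the clipped function pointwise. Equal masses then force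
    equality almost everywhere, possible only if the floor is active almost everywhere on
    \<open>K\<close>; but then the mass is below 1.\<close>
  have unique: False if "0 < a" "a < b" "(\<integral>x. clipped w K \<delta> a x \<partial>lebesgue) = 1"
    "(\<integral>x. clipped w K \<delta> b x \<partial>lebesgue) = 1" for a b
  proof -
    have le: "clipped w K \<delta> b x \<le> clipped w K \<delta> a x" for x
    proof (cases "w x \<ge> 0")
      case True
      then have "w x / b \<le> w x / a" using that by (intro divide_left_mono) auto
      then show ?thesis by (auto simp: clipped_def)
    next
      case False
      then have "w x / b \<le> 0" "w x / a \<le> 0" using that by (auto simp: divide_nonpos_pos)
      then show ?thesis using \<delta>(1) by (auto simp: clipped_def)
    qed
    have "AE x in lebesgue. clipped w K \<delta> a x - clipped w K \<delta> b x = 0"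
      using le that int by (subst integral_nonneg_eq_0_iff_AE [symmetric]) auto
    then have "AE x in lebesgue. x \<in> K \<longrightarrow> w x / a \<le> \<delta>"
    proof eventually_elim
      case (elim x)
      show ?case
      proof (rule ccontr)
        assume *: "\<not> ?thesis"
        then have "0 < w x / a" using \<delta>(1) by auto
        then have "0 < w x" using that by (simp add: zero_less_divide_iff)
        then have "w x / b < w x / a" using that by (intro divide_strict_left_mono) auto
        then show False using * elim by (auto simp: clipped_def)
      qed
    qed
    then have "(\<integral>x. clipped w K \<delta> a x \<partial>lebesgue) = \<delta> * measure lebesgue K"
      using w(1) K \<delta>(1) by (intro integral_clipped_floor)
    then show False using that \<delta>(2) by simp
  qed
  have one: "(\<integral>x. clipped w K \<delta> (1 / t) x \<partial>lebesgue) = 1" "0 < 1 / t"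
    using t \<open>t \<noteq> 0\<close> by (auto simp: F_eq)
  show ?thesis
  proof
    show "(\<integral>x. clipped w K \<delta> z' x \<partial>lebesgue) = 1 \<longleftrightarrow> z' = 1 / t" if "0 < z'" for z'
      using that one unique [of z' "1 / t"] unique [of "1 / t" z'] by (metis linorder_neqE)
  qed (fact one)
qed

section \<open>The objective of a single class\<close>

lemma ereal_integral_ge_of_neg_part:
  assumes "f \<in> borel_measurable M" "(\<integral>\<^sup>+ x. e2ennreal (- f x) \<partial>M) \<le> ennreal C" "0 \<le> C"
  shows "quasi_integrable M f" "ereal (- C) \<le> ereal_integral M f"
proof -
  have fin: "(\<integral>\<^sup>+ x. e2ennreal (- f x) \<partial>M) < \<infinity>"
    using assms(2) by (auto simp: le_less_trans)
  then show "quasi_integrable M f" using assms(1) by (simp add: quasi_integrable_def)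
  have "enn2ereal (\<integral>\<^sup>+ x. e2ennreal (- f x) \<partial>M) \<le> ereal C"
    using assms(2,3) by (simp add: less_eq_ennreal.rep_eq enn2ereal_ennreal)
  then have "0 - ereal C \<le> ereal_integral M f"
    unfolding ereal_integral_def by (intro ereal_minus_mono) auto
  then show "ereal (- C) \<le> ereal_integral M f" by simp
qed

lemma quasi_integrable_cong_AE:
  assumes "quasi_integrable M g" "AE x in M. f x = g x" "f \<in> borel_measurable M"
  shows "quasi_integrable M f"
proof -
  have "(\<integral>\<^sup>+ x. e2ennreal (f x) \<partial>M) = (\<integral>\<^sup>+ x. e2ennreal (g x) \<partial>M)"
    "(\<integral>\<^sup>+ x. e2ennreal (- f x) \<partial>M) = (\<integral>\<^sup>+ x. e2ennreal (- g x) \<partial>M)"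
    using assms(2) by (auto intro!: nn_integral_cong_AE elim!: eventually_mono)
  then show ?thesis using assms by (simp add: quasi_integrable_def)
qed

text \<open>Only the negative part is controlled; the value may be \<open>\<infinity>\<close>. The
  bound depends on the class only through the L1 norm of \<open>w\<close>.\<close>

lemma class_objective_clipped_bound:
  fixes w :: "real ^ 'd \<Rightarrow> real"
  assumes w: "integrable lebesgue w" and K: "K \<in> lmeasurable" "{x. w x \<noteq> 0} \<subseteq> K"
    and pos: "0 < z" "0 < \<delta>"
  shows "quasi_integrable lebesgue (\<lambda>x. ereal (ln (clipped w K \<delta> z x) * w x))"
    and "ereal (- (\<bar>ln \<delta>\<bar> * (\<integral>x. \<bar>w x\<bar> \<partial>lebesgue))) \<le> class_objective w (clipped w K \<delta> z)"
proof -
  have [measurable]: "w \<in> borel_measurable lebesgue" "clipped w K \<delta> z \<in> borel_measurable lebesgue"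
    using w integrable_clipped [OF w K] by auto
  have bound: "- (ln (clipped w K \<delta> z x) * w x) \<le> \<bar>ln \<delta>\<bar> * \<bar>w x\<bar>" for x
  proof (cases "w x > 0")
    case True
    then have "x \<in> K" using K(2) by auto
    then have "ln \<delta> \<le> ln (clipped w K \<delta> z x)"
      using pos by (auto simp: clipped_def)
    then have "- ln (clipped w K \<delta> z x) * w x \<le> \<bar>ln \<delta>\<bar> * w x"
      using True by (intro mult_right_mono) auto
    then show ?thesis using True by simp
  next
    case False
    then have "w x / z \<le> 0" using pos by (simp add: divide_nonpos_pos)
    \<comment> \<open>Where the weight is negative the floor is active, so the logarithm is exactly
      \<open>ln \<delta>\<close>.\<close>
    then have "w x = 0 \<or> clipped w K \<delta> z x = \<delta>"
      using K(2) pos by (auto simp: clipped_def)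
    then show ?thesis
      by (metis abs_ge_minus_self abs_mult abs_zero mult_zero_right neg_equal_zero order_refl)
  qed
  have "(\<integral>\<^sup>+ x. e2ennreal (- ereal (ln (clipped w K \<delta> z x) * w x)) \<partial>lebesgue) \<le>
      (\<integral>\<^sup>+ x. ennreal (\<bar>ln \<delta>\<bar> * \<bar>w x\<bar>) \<partial>lebesgue)"
    using bound by (intro nn_integral_mono) (auto simp: e2ennreal_ereal intro!: ennreal_leI)
  also have "\<dots> = ennreal (\<integral>x. \<bar>ln \<delta>\<bar> * \<bar>w x\<bar> \<partial>lebesgue)"
    using w by (intro nn_integral_eq_integral) auto
  finally have neg: "(\<integral>\<^sup>+ x. e2ennreal (- ereal (ln (clipped w K \<delta> z x) * w x)) \<partial>lebesgue) \<le>
      ennreal (\<bar>ln \<delta>\<bar> * (\<integral>x. \<bar>w x\<bar> \<partial>lebesgue))" by simp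
  have nonneg: "0 \<le> \<bar>ln \<delta>\<bar> * (\<integral>x. \<bar>w x\<bar> \<partial>lebesgue)"
    by (intro mult_nonneg_nonneg integral_nonneg) auto
  have meas: "(\<lambda>x. ereal (ln (clipped w K \<delta> z x) * w x)) \<in> borel_measurable lebesgue"
    by measurable
  show "quasi_integrable lebesgue (\<lambda>x. ereal (ln (clipped w K \<delta> z x) * w x))"
    and "ereal (- (\<bar>ln \<delta>\<bar> * (\<integral>x. \<bar>w x\<bar> \<partial>lebesgue))) \<le> class_objective w (clipped w K \<delta> z)"
    unfolding class_objective_def by (fact ereal_integral_ge_of_neg_part [OF meas neg nonneg])+
qed

text \<open>Integrates \<open>log_clip_tangent\<close>. The second claim asks for a finite value
  because equality of two infinite values says nothing about the integrands.\<close>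

lemma class_objective_clipped_max:
  fixes w q :: "real ^ 'd \<Rightarrow> real"
  assumes w: "integrable lebesgue w" and K: "K \<in> lmeasurable" "{x. w x \<noteq> 0} \<subseteq> K"
    and pos: "0 < z" "0 < \<delta>"
    and one: "(\<integral>x. clipped w K \<delta> z x \<partial>lebesgue) = 1"
    and q: "prob_density q" "\<And>x. x \<in> K \<Longrightarrow> \<delta> \<le> q x"
  shows "class_objective w q \<le> class_objective w (clipped w K \<delta> z)"
    and "class_objective w q = class_objective w (clipped w K \<delta> z) \<Longrightarrow>
      class_objective w (clipped w K \<delta> z) < \<infinity> \<Longrightarrow> AE x in lebesgue. q x = clipped w K \<delta> z x"
proof -
  let ?s = "clipped w K \<delta> z"
  have q_int: "integrable lebesgue q" "(\<integral>x. q x \<partial>lebesgue) = 1" and q0: "\<And>x. 0 \<le> q x"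
    using q(1) by (auto simp: prob_density_def)
  have s_int: "integrable lebesgue ?s" using w K by (rule integrable_clipped)
  have [measurable]: "w \<in> borel_measurable lebesgue" "?s \<in> borel_measurable lebesgue"
      "q \<in> borel_measurable lebesgue" "K \<in> sets lebesgue"
    using w s_int q_int K(1) by auto
  have s_off: "?s x = 0" if "x \<notin> K" for x using that by (simp add: clipped_def)
  define f where "f x = ln (?s x) * w x" for x
  \<comment> \<open>Cutting \<open>q\<close> off outside \<open>K\<close> makes the tangent
    inequality hold everywhere, since all its terms vanish there.\<close>
  define g where "g x = indicat_real K x * q x - ?s x" for x
  have Kq_int: "integrable lebesgue (\<lambda>x. indicat_real K x * q x)"
    using q_int(1) integrable_mult_indicator [of K lebesgue q] by simp
  have g_int: "integrable lebesgue g"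
    unfolding g_def using Kq_int s_int by simp
  have out_int: "integrable lebesgue (\<lambda>x. q x - indicat_real K x * q x)"
    using Kq_int q_int by simp
  \<comment> \<open>As \<open>clipped w K \<delta> z\<close> and \<open>q\<close> both have mass 1,
    the integral of \<open>g\<close> is minus the mass that \<open>q\<close> wastes outside
    \<open>K\<close>.\<close>
  have g_eq: "(\<integral>x. g x \<partial>lebesgue) = - (\<integral>x. q x - indicat_real K x * q x \<partial>lebesgue)"
    unfolding g_def using Kq_int s_int q_int one by simp
  have out0: "0 \<le> q x - indicat_real K x * q x" for x
    using q0 by (simp add: indicator_def)
  have g_le: "(\<integral>x. g x \<partial>lebesgue) \<le> 0"
    unfolding g_eq using out0 by (simp add: integral_nonneg)
  have tangent: "ln (q x) * w x \<le> f x + z * g x" for x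
  proof (cases "x \<in> K")
    case True
    then show ?thesis
      using log_clip_tangent(1) [OF pos q(2) [OF True], of "w x"] by (simp add: f_def g_def clipped_def)
  next
    case False
    then have "w x = 0" using K(2) by auto
    then show ?thesis using False by (simp add: f_def g_def s_off)
  qed
  \<comment> \<open>A finite value makes \<open>f\<close> integrable, so the right-hand side of the
    tangent inequality can be integrated term by term.\<close>
  have obj: "ereal_integral lebesgue (\<lambda>x. ereal (f x + z * g x)) =
        ereal ((\<integral>x. f x \<partial>lebesgue) + z * (\<integral>x. g x \<partial>lebesgue))"
      "class_objective w ?s = ereal (\<integral>x. f x \<partial>lebesgue)"
    if fin: "class_objective w ?s < \<infinity>"
  proof -
    have "\<bar>class_objective w ?s\<bar> \<noteq> \<infinity>"
      using fin class_objective_clipped_bound(2) [OF w K pos] by auto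
    then have f_int: "integrable lebesgue f"
      using ereal_integral_finite_imp_integrable(2) [of "\<lambda>x. ereal (f x)" lebesgue]
      by (simp add: class_objective_def f_def [abs_def])
    then show "ereal_integral lebesgue (\<lambda>x. ereal (f x + z * g x)) =
        ereal ((\<integral>x. f x \<partial>lebesgue) + z * (\<integral>x. g x \<partial>lebesgue))"
      using g_int by (subst ereal_integral_eq_integral) auto
    show "class_objective w ?s = ereal (\<integral>x. f x \<partial>lebesgue)"
      using ereal_integral_eq_integral [OF f_int] by (simp add: class_objective_def f_def [abs_def])
  qed
  have le: "class_objective w q \<le> ereal_integral lebesgue (\<lambda>x. ereal (f x + z * g x))"
    unfolding class_objective_def using tangent by (intro ereal_integral_mono) auto
  have zg_le: "z * (\<integral>x. g x \<partial>lebesgue) \<le> 0"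
    using g_le pos by (simp add: mult_nonneg_nonpos)
  show "class_objective w q \<le> class_objective w ?s"
  proof (cases "class_objective w ?s < \<infinity>")
    case True
    show ?thesis using le unfolding obj [OF True] by (rule order_trans) (use zg_le in simp)
  qed (simp add: less_top)
  show "AE x in lebesgue. q x = ?s x"
    if eq: "class_objective w q = class_objective w ?s" and fin: "class_objective w ?s < \<infinity>"
  proof -
    \<comment> \<open>The chain from \<open>class_objective w q\<close> through the integrated
      tangent bound to the clipped value collapses, so \<open>q\<close> has no mass outside
      \<open>K\<close> and the tangent inequality is tight almost everywhere.\<close>
    have zg: "z * (\<integral>x. g x \<partial>lebesgue) = 0"
      using le zg_le unfolding eq obj [OF fin] by simp
    have "AE x in lebesgue. ereal (ln (q x) * w x) = ereal (f x + z * g x)"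
    proof (rule ereal_integral_eq_imp_AE_eq)
      show "(\<lambda>x. ereal (f x + z * g x)) \<in> borel_measurable lebesgue"
        unfolding f_def g_def by measurable
      show "ereal_integral lebesgue (\<lambda>x. ereal (ln (q x) * w x)) =
          ereal_integral lebesgue (\<lambda>x. ereal (f x + z * g x))"
        using eq zg unfolding obj [OF fin] by (simp add: class_objective_def)
    qed (use tangent in \<open>auto simp: obj [OF fin]\<close>)
    moreover have "AE x in lebesgue. q x - indicat_real K x * q x = 0"
      using zg pos g_eq out0 out_int by (subst integral_nonneg_eq_0_iff_AE [symmetric]) auto
    ultimately show ?thesis
    proof eventually_elim
      case (elim x)
      show ?case
      proof (cases "x \<in> K")
        case True
        then show ?thesis
          using log_clip_tangent(2) [OF pos q(2) [OF True], of "w x"] elim(1)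
          by (simp add: f_def g_def clipped_def)
      next
        case False
        then show ?thesis using elim(2) by (simp add: s_off)
      qed
    qed
  qed
qed

section \<open>The marginal and the guided weight\<close>

text \<open>Tonelli with measurability given only for each class separately: the support of a pmf is
  countable, so the integral over classes is a series of measurable functions.\<close>

lemma nn_integral_pmf_swap:
  fixes f :: "'c \<Rightarrow> 'a \<Rightarrow> ennreal"
  assumes "\<And>c. f c \<in> borel_measurable M"
  shows "(\<lambda>x. \<integral>\<^sup>+ c. f c x \<partial>measure_pmf P) \<in> borel_measurable M"
    and "(\<integral>\<^sup>+ x. \<integral>\<^sup>+ c. f c x \<partial>measure_pmf P \<partial>M) = (\<integral>\<^sup>+ c. \<integral>\<^sup>+ x. f c x \<partial>M \<partial>measure_pmf P)"
proof -
  note [measurable] = assms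
  \<comment> \<open>\<open>N\<close> is \<open>P\<close> transported to the naturals and
    \<open>e\<close> decodes it. Indices that encode no class of the support have weight 0 under
    \<open>N\<close>.\<close>
  define e where "e = from_nat_into (set_pmf P)"
  define N where "N = map_pmf (to_nat_on (set_pmf P)) P"
  have "map_pmf e N = map_pmf id P"
    unfolding N_def map_pmf_comp by (rule map_pmf_cong) (auto simp: e_def countable_set_pmf)
  then have P: "P = map_pmf e N" by simp
  have series: "(\<integral>\<^sup>+ c. u c \<partial>measure_pmf P) = (\<Sum>i. ennreal (pmf N i) * u (e i))" for u
    by (subst P, subst nn_integral_map_pmf)
      (simp add: nn_integral_measure_pmf nn_integral_count_space_nat)
  show "(\<lambda>x. \<integral>\<^sup>+ c. f c x \<partial>measure_pmf P) \<in> borel_measurable M"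
    unfolding series by measurable
  show "(\<integral>\<^sup>+ x. \<integral>\<^sup>+ c. f c x \<partial>measure_pmf P \<partial>M) = (\<integral>\<^sup>+ c. \<integral>\<^sup>+ x. f c x \<partial>M \<partial>measure_pmf P)"
    unfolding series by (simp add: nn_integral_suminf nn_integral_cmult)
qed

lemma prob_density_marginal:
  assumes p: "\<And>c. prob_density (p c)"
  shows "prob_density (marginal prior p)"
proof -
  have p0: "0 \<le> p c x" and pint: "integrable lebesgue (p c)" "(\<integral>x. p c x \<partial>lebesgue) = 1" for c x
    using p by (auto simp: prob_density_def)
  have pm [measurable]: "p c \<in> borel_measurable lebesgue" for c using pint by auto
  define s where "s x = (\<integral>\<^sup>+ c. ennreal (p c x) \<partial>measure_pmf prior)" for x
  have sm [measurable]: "s \<in> borel_measurable lebesgue"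
    unfolding s_def by (rule nn_integral_pmf_swap) simp
  have "(\<integral>\<^sup>+ x. ennreal (p c x) \<partial>lebesgue) = 1" for c
    using pint p0 by (simp add: nn_integral_eq_integral)
  then have s1: "(\<integral>\<^sup>+ x. s x \<partial>lebesgue) = 1"
    unfolding s_def by (subst nn_integral_pmf_swap(2)) (simp_all add: measure_pmf.emeasure_space_1)
  \<comment> \<open>Where \<open>s x = \<infinity>\<close> both sides are 0, by the defaults of the
    Bochner integral and of \<open>enn2real\<close>. Such points form a null set because
    \<open>s\<close> has integral 1.\<close>
  have m: "marginal prior p x = enn2real (s x)" for x
    unfolding marginal_def s_def using p0 by (intro integral_eq_nn_integral) auto
  have "AE x in lebesgue. s x \<noteq> \<infinity>"
    using s1 by (intro nn_integral_PInf_AE) auto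
  then have "(\<integral>\<^sup>+ x. ennreal (marginal prior p x) \<partial>lebesgue) = (\<integral>\<^sup>+ x. s x \<partial>lebesgue)"
    by (intro nn_integral_cong_AE) (auto elim!: eventually_mono simp: m less_top)
  then have nn: "(\<integral>\<^sup>+ x. ennreal (marginal prior p x) \<partial>lebesgue) = ennreal 1" using s1 by simp
  have mm: "marginal prior p \<in> borel_measurable lebesgue" unfolding m [abs_def] by measurable
  have m0: "0 \<le> marginal prior p x" for x by (simp add: m)
  have "has_bochner_integral lebesgue (marginal prior p) 1"
    using nn mm m0 by (intro has_bochner_integral_nn_integral) auto
  then show ?thesis
    using m0 by (auto simp: prob_density_def has_bochner_integral_iff)
qed

text \<open>The correction term integrates to 0, so guidance preserves the mass 1. The L1 bound
  comes from the triangle inequality and is the same for all classes, which later controls the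
  average over the prior.\<close>

lemma guided_integral:
  assumes p: "\<And>c. prob_density (p c)" and "0 \<le> \<eta>"
  shows "integrable lebesgue (guided prior \<eta> p c)"
    and "(\<integral>x. guided prior \<eta> p c x \<partial>lebesgue) = 1"
    and "(\<integral>x. \<bar>guided prior \<eta> p c x\<bar> \<partial>lebesgue) \<le> 1 + 2 * \<eta>"
proof -
  have pc: "integrable lebesgue (p c)" "(\<integral>x. p c x \<partial>lebesgue) = 1" "\<And>x. 0 \<le> p c x"
    using p by (auto simp: prob_density_def)
  have m: "integrable lebesgue (marginal prior p)" "(\<integral>x. marginal prior p x \<partial>lebesgue) = 1"
      "\<And>x. 0 \<le> marginal prior p x"
    using prob_density_marginal [of p prior, OF p] by (auto simp: prob_density_def)
  show int: "integrable lebesgue (guided prior \<eta> p c)"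
    unfolding guided_def [abs_def] using pc m by simp
  show "(\<integral>x. guided prior \<eta> p c x \<partial>lebesgue) = 1"
    unfolding guided_def [abs_def] using pc m by simp
  have "(\<integral>x. \<bar>guided prior \<eta> p c x\<bar> \<partial>lebesgue) \<le>
      (\<integral>x. (1 + \<eta>) * p c x + \<eta> * marginal prior p x \<partial>lebesgue)"
  proof (rule integral_mono)
    fix x
    have "0 \<le> \<eta> * p c x" "0 \<le> \<eta> * marginal prior p x"
      using pc(3) m(3) assms(2) by auto
    then show "\<bar>guided prior \<eta> p c x\<bar> \<le> (1 + \<eta>) * p c x + \<eta> * marginal prior p x"
      using pc(3) [of x] unfolding guided_def ring_distribs by linarith
  qed (use int pc m in auto)
  also have "\<dots> = 1 + 2 * \<eta>" using pc m by simp
  finally show "(\<integral>x. \<bar>guided prior \<eta> p c x\<bar> \<partial>lebesgue) \<le> 1 + 2 * \<eta>" .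
qed

section \<open>Combination over the classes\<close>

theorem theorem1:
  fixes prior :: "'c pmf"
    and p :: "'c \<Rightarrow> real ^ 'd \<Rightarrow> real"
    and K :: "(real ^ 'd) set"
    and \<eta> \<delta> :: real
    and h :: "'c \<Rightarrow> real ^ 'd \<Rightarrow> real"
  defines "h \<equiv> guided prior \<eta> p"
  assumes "\<And>c. prob_density (p c)"
    and "0 \<le> \<eta>"
    and "K \<in> lmeasurable"
    and "\<And>c. {x. h c x \<noteq> 0} \<subseteq> K"
    and "0 < \<delta>" and "\<delta> < 1 / measure lebesgue K"
  shows "\<exists>Z.
    (\<forall>c. 0 < Z c \<and> (\<forall>z>0. (\<integral>x. clipped (h c) K \<delta> z x \<partial>lebesgue) = 1 \<longleftrightarrow> z = Z c)) \<and>
    optimal prior h K \<delta> (\<lambda>c. clipped (h c) K \<delta> (Z c)) \<and>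
    (objective prior h (\<lambda>c. clipped (h c) K \<delta> (Z c)) < \<infinity> \<longrightarrow>
      (\<forall>q. feasible K \<delta> q \<longrightarrow>
        (optimal prior h K \<delta> q \<longleftrightarrow>
          (\<forall>c \<in> set_pmf prior. AE x in lebesgue. q c x = clipped (h c) K \<delta> (Z c) x))))"
proof -
  have h: "integrable lebesgue (h c)" "(\<integral>x. h c x \<partial>lebesgue) = 1"
      "(\<integral>x. \<bar>h c x\<bar> \<partial>lebesgue) \<le> 1 + 2 * \<eta>" for c
    unfolding h_def using guided_integral [of p \<eta> prior c] assms(2,3) by auto
  \<comment> \<open>As \<open>1 / 0 = 0\<close>, a null set \<open>K\<close> would contradict
    \<open>0 < \<delta>\<close> and \<open>\<delta> < 1 / measure lebesgue K\<close>.\<close>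
  have "measure lebesgue K \<noteq> 0" using assms(6,7) by auto
  then have vol: "0 < measure lebesgue K" by (simp add: zero_less_measure_iff)
  then have mass: "\<delta> * measure lebesgue K < 1" using assms(7) by (simp add: field_simps)
  have "\<exists>z>0. \<forall>z'>0. (\<integral>x. clipped (h c) K \<delta> z' x \<partial>lebesgue) = 1 \<longleftrightarrow> z' = z" for c
    by (rule clipped_normalizer [OF h(1,2) assms(4,5,6) mass, of c]) blast
  then obtain Z where Z: "\<And>c. 0 < Z c"
      "\<And>c z. 0 < z \<Longrightarrow> (\<integral>x. clipped (h c) K \<delta> z x \<partial>lebesgue) = 1 \<longleftrightarrow> z = Z c"
    by metis
  define s where "s c = clipped (h c) K \<delta> (Z c)" for c
  have one: "(\<integral>x. s c x \<partial>lebesgue) = 1" for c using Z by (simp add: s_def)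
  have feas: "feasible K \<delta> s"
    unfolding feasible_def prob_density_def
  proof (intro allI conjI ballI)
    fix c x
    show "0 \<le> s c x" using assms(6) by (auto simp: s_def clipped_def)
    show "integrable lebesgue (s c)" unfolding s_def using h(1) assms(4,5) by (rule integrable_clipped)
    show "(\<integral>x. s c x \<partial>lebesgue) = 1" by (fact one)
    show "\<delta> \<le> s c x" if "x \<in> K" using that by (simp add: s_def clipped_def)
  qed
  define C where "C = \<bar>ln \<delta>\<bar> * (1 + 2 * \<eta>)"
  have C: "0 \<le> C" using assms(3) by (simp add: C_def)
  have class_ge: "ereal (- C) \<le> class_objective (h c) (s c)" for c
  proof (rule order_trans)
    show "ereal (- (\<bar>ln \<delta>\<bar> * (\<integral>x. \<bar>h c x\<bar> \<partial>lebesgue))) \<le> class_objective (h c) (s c)"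
      unfolding s_def using h(1) assms(4,5) Z(1) assms(6) by (rule class_objective_clipped_bound(2))
    show "ereal (- C) \<le> ereal (- (\<bar>ln \<delta>\<bar> * (\<integral>x. \<bar>h c x\<bar> \<partial>lebesgue)))"
      using h(3) by (simp add: C_def mult_left_mono)
  qed
  \<comment> \<open>The prior has mass 1, so the uniform class bound \<open>C\<close> survives
    averaging. Hence the objective of \<open>s\<close> is defined and not
    \<open>-\<infinity>\<close>.\<close>
  have neg_le: "(\<integral>\<^sup>+ c. e2ennreal (- class_objective (h c) (s c)) \<partial>measure_pmf prior) \<le> ennreal C"
  proof -
    have "(\<integral>\<^sup>+ c. e2ennreal (- class_objective (h c) (s c)) \<partial>measure_pmf prior) \<le>
        (\<integral>\<^sup>+ c. ennreal C \<partial>measure_pmf prior)"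
    proof (rule nn_integral_mono)
      fix c
      have "- class_objective (h c) (s c) \<le> ereal C"
        using class_ge [of c] by (simp add: ereal_uminus_le_reorder)
      then show "e2ennreal (- class_objective (h c) (s c)) \<le> ennreal C"
        by (metis e2ennreal_ereal e2ennreal_mono)
    qed
    then show ?thesis by (simp add: measure_pmf.emeasure_space_1)
  qed
  have obj_ge: "ereal (- C) \<le> objective prior h s"
    unfolding objective_def using neg_le C by (intro ereal_integral_ge_of_neg_part) auto
  have "quasi_integrable (measure_pmf prior) (\<lambda>c. class_objective (h c) (s c))"
    using neg_le C by (intro ereal_integral_ge_of_neg_part) auto
  then have def_s: "objective_defined prior h s"
    using class_objective_clipped_bound(1) [OF h(1) assms(4,5) Z(1) assms(6)]
    by (simp add: objective_defined_def s_def)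
  have class_le: "class_objective (h c) (q c) \<le> class_objective (h c) (s c)"
    and class_eq: "class_objective (h c) (q c) = class_objective (h c) (s c) \<Longrightarrow>
      class_objective (h c) (s c) < \<infinity> \<Longrightarrow> AE x in lebesgue. q c x = s c x"
    if "feasible K \<delta> q" for q c
    using class_objective_clipped_max [OF h(1) assms(4,5) Z(1) assms(6) one [unfolded s_def], of "q c"] that
    by (auto simp: feasible_def s_def)
  have obj_le: "objective prior h q \<le> objective prior h s" if "feasible K \<delta> q" for q
    unfolding objective_def using class_le [OF that] by (intro ereal_integral_mono) auto
  have opt: "optimal prior h K \<delta> s"
    using feas def_s obj_le by (simp add: optimal_def)
  have uniq: "optimal prior h K \<delta> q \<longleftrightarrow> (\<forall>c \<in> set_pmf prior. AE x in lebesgue. q c x = s c x)"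
    if fin: "objective prior h s < \<infinity>" and q: "feasible K \<delta> q" for q
  proof
    assume "optimal prior h K \<delta> q"
    then have eq: "objective prior h q = objective prior h s"
      using obj_le [OF q] feas def_s by (auto simp: optimal_def intro: antisym)
    have fin': "\<bar>objective prior h s\<bar> \<noteq> \<infinity>" using fin obj_ge by auto
    \<comment> \<open>Equality passes from the average to the classes; under a pmf, almost
      everywhere means at every class of the support.\<close>
    have "AE c in prior. class_objective (h c) (q c) = class_objective (h c) (s c)"
      using class_le [OF q] eq fin' unfolding objective_def
      by (intro ereal_integral_eq_imp_AE_eq) auto
    \<comment> \<open>A finite average makes each class value on the support finite, as
      \<open>class_eq\<close> requires.\<close>
    moreover have "AE c in prior. class_objective (h c) (s c) =
        ereal (real_of_ereal (class_objective (h c) (s c)))"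
      using fin' unfolding objective_def by (intro ereal_integral_finite_imp_integrable(1)) auto
    ultimately show "\<forall>c \<in> set_pmf prior. AE x in lebesgue. q c x = s c x"
      unfolding AE_measure_pmf_iff
    proof (intro ballI)
      fix c assume c: "c \<in> set_pmf prior"
        and eq: "\<forall>c\<in>set_pmf prior. class_objective (h c) (q c) = class_objective (h c) (s c)"
        and real: "\<forall>c\<in>set_pmf prior. class_objective (h c) (s c) =
          ereal (real_of_ereal (class_objective (h c) (s c)))"
      have "class_objective (h c) (s c) < \<infinity>"
        by (subst real [rule_format, OF c]) simp
      then show "AE x in lebesgue. q c x = s c x"
        by (rule class_eq [OF q eq [rule_format, OF c]])
    qed
  next
    assume ae: "\<forall>c \<in> set_pmf prior. AE x in lebesgue. q c x = s c x"
    \<comment> \<open>Conversely, changes on null sets for each class of the support alter neither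
      the objective nor its being defined.\<close>
    have ae': "AE x in lebesgue. ereal (ln (q c x) * h c x) = ereal (ln (s c x) * h c x)"
      if "c \<in> set_pmf prior" for c
      using ae [rule_format, OF that] by eventually_elim simp
    have cl: "AE c in prior. class_objective (h c) (q c) = class_objective (h c) (s c)"
      using ereal_integral_cong_AE [OF ae'] by (simp add: AE_measure_pmf_iff class_objective_def)
    have eq: "objective prior h q = objective prior h s"
      unfolding objective_def using cl by (rule ereal_integral_cong_AE)
    have "objective_defined prior h q"
      unfolding objective_defined_def
    proof (intro conjI ballI)
      fix c assume c: "c \<in> set_pmf prior"
      have [measurable]: "q c \<in> borel_measurable lebesgue" "h c \<in> borel_measurable lebesgue"
        using q h(1) by (auto simp: feasible_def prob_density_def)
      show "quasi_integrable lebesgue (\<lambda>x. ereal (ln (q c x) * h c x))"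
        using def_s c by (intro quasi_integrable_cong_AE [OF _ ae' [OF c]]) (auto simp: objective_defined_def)
    next
      show "quasi_integrable (measure_pmf prior) (\<lambda>c. class_objective (h c) (q c))"
        using def_s by (intro quasi_integrable_cong_AE [OF _ cl]) (auto simp: objective_defined_def)
    qed
    then show "optimal prior h K \<delta> q"
      using q eq obj_le by (simp add: optimal_def)
  qed
  show ?thesis
    by (intro exI [of _ Z] conjI allI impI; (fold s_def)?)
      (simp_all add: Z opt uniq)
qed

end
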